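(* Let $a,b,c,e_1,e_2,e_3,e_4\in\mathbb{C}$ with $\mathrm{Re}(a)>0$, $\mathrm{Re}(b)>0$, $\mathrm{Re}(c)>0$, $\mathrm{Re}(e_1)>0$, $\mathrm{Re}(e_2)>0$, $\mathrm{Re}(e_3)>0$ and $\mathrm{Re}(e_4)>0$. Then $$\begin{aligned} &\left(1-x\hat D_{t_1}t_2^{-1}\hat D_{t_2}^{-1}t_1-y\hat D_{t_1}t_3^{-1}\hat D_{t_3}^{-1}t_1-u\hat D_{t_1}t_5^{-1}\hat D_{t_5}^{-1}t_1\right)^{-b}\left(1-z\hat D_{t_1}t_4^{-1}\hat D_{t_4}^{-1}t_1\right)^{-c}\\ &\qquad\times\left\{t_1^{a-1}t_2^{e_1-1}t_3^{e_2-1}t_4^{e_3-1}t_5^{e_4-1}\right\}\\ &=\left\{t_1^{a-1}t_2^{e_1-1}t_3^{e_2-1}t_4^{e_3-1}t_5^{e_4-1}\right\}\,K_2[a,a,a,a;b,b,c,b;e_1,e_2,e_3,e_4;x,y,z,u], \end{aligned}$$ and $$\begin{aligned} &\left(1-x\hat D_{t_1}t_3^{-1}\hat D_{t_3}^{-1}t_1-y\hat D_{t_1}t_4^{-1}\hat D_{t_4}^{-1}t_1-z\hat D_{t_2}t_5^{-1}\hat D_{t_5}^{-1}t_2-u\hat D_{t_1}t_6^{-1}\hat D_{t_6}^{-1}t_1\right)^{-a}\\ &\qquad\times\left\{t_1^{b-1}t_2^{c-1}t_3^{e_1-1}t_4^{e_2-1}t_5^{e_3-1}t_6^{e_4-1}\right\}\\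 &=\left\{t_1^{b-1}t_2^{c-1}t_3^{e_1-1}t_4^{e_2-1}t_5^{e_3-1}t_6^{e_4-1}\right\}\,K_2[a,a,a,a;b,b,c,b;e_1,e_2,e_3,e_4;x,y,z,u]. \end{aligned}$$
   Context: $(\lambda)_n=\lambda(\lambda+1)\cdots(\lambda+n-1)$, $(\lambda)_0=1$. The quadruple hypergeometric function $K_2$ is $$K_2[a,a,a,a;b,b,c,b;e_1,e_2,e_3,e_4;x,y,z,u]=\sum_{m,n,p,q=0}^{\infty}\frac{(a)_{m+n+p+q}(b)_{m+n+q}(c)_p}{(e_1)_m(e_2)_n(e_3)_p(e_4)_q}\frac{x^my^nz^pu^q}{m!\,n!\,p!\,q!}.$$ The variables $t_i$ are positive reals. For an integer $m\ge 0$, $\hat D_{t}^{m}$ and $\hat D_t^{-m}$ denote the $m$-th derivative and the $m$-fold integral (lower limit $0$) in $t$, acting on powers by $$\hat D_t^{m}t^{\lambda}=\frac{\Gamma(\lambda+1)}{\Gamma(\lambda-m+1)}t^{\lambda-m},\qquad \hat D_t^{-m}t^{\lambda}=\frac{\Gamma(\lambda+1)}{\Gamma(\lambda+m+1)}t^{\lambda+m},\qquad \lambda\notin\{-1,-2,\dots\}.$$ Convention for the operator powers: they are expanded by the binomial/multinomial theorem $(1-X_1-\cdots-X_k)^{-\lambda}=\sum_{n_1,\dots,n_k\ge0}(\lambda)_{n_1+\cdots+n_k}\frac{X_1^{n_1}\cdots X_k^{n_k}}{n_1!\cdots n_k!}$, treating all symbols as commuting, and each resulting monomial is then read in the order: first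 multiply by all positive powers of the variables $t_i$, then apply the derivatives and integrals, then multiply by all negative powers of the $t_i$. Thus, for instance, the left-hand side of the first identity means $$\sum_{m,n,p,q=0}^{\infty}\frac{(b)_{m+n+q}(c)_p\,x^my^nz^pu^q}{m!\,n!\,p!\,q!}\,t_2^{-m}t_3^{-n}t_4^{-p}t_5^{-q}\,\hat D_{t_1}^{m+n+p+q}\hat D_{t_2}^{-m}\hat D_{t_3}^{-n}\hat D_{t_4}^{-p}\hat D_{t_5}^{-q}\left\{t_1^{a+m+n+p+q-1}t_2^{e_1-1}t_3^{e_2-1}t_4^{e_3-1}t_5^{e_4-1}\right\},$$ and the left-hand side of the second identity means $$\sum_{m,n,p,q=0}^{\infty}\frac{(a)_{m+n+p+q}\,x^my^nz^pu^q}{m!\,n!\,p!\,q!}\,t_3^{-m}t_4^{-n}t_5^{-p}t_6^{-q}\,\hat D_{t_1}^{m+n+q}\hat D_{t_2}^{p}\hat D_{t_3}^{-m}\hat D_{t_4}^{-n}\hat D_{t_5}^{-p}\hat D_{t_6}^{-q}\left\{t_1^{b+m+n+q-1}t_2^{c+p-1}t_3^{e_1-1}t_4^{e_2-1}t_5^{e_3-1}t_6^{e_4-1}\right\}.$$ The identities are identities of power series in $x,y,z,u$ (termwise). *)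

theory Defs
  imports "HOL-Analysis.Analysis" "HOL-Library.Multiset"
begin

text \<open>
  The variables \<open>t\<^sub>1, t\<^sub>2, \<dots>\<close> are the values \<open>t 1, t 2, \<dots>\<close> of some \<open>t :: nat \<Rightarrow> real\<close>.
\<close>

definition deriv_var :: "nat \<Rightarrow> ((nat \<Rightarrow> real) \<Rightarrow> complex) \<Rightarrow> (nat \<Rightarrow> real) \<Rightarrow> complex" where
  "deriv_var i F t = vector_derivative (\<lambda>s. F (t(i := s))) (at (t i))"

definition integral_var :: "nat \<Rightarrow> ((nat \<Rightarrow> real) \<Rightarrow> complex) \<Rightarrow> (nat \<Rightarrow> real) \<Rightarrow> complex" where
  "integral_var i F t = integral {0..t i} (\<lambda>s. F (t(i := s)))"

text \<open>
  The symbols \<open>t\<^sub>i\<close>, \<open>t\<^sub>i\<close> to the power \<open>-1\<close>, \<open>D\<close> and \<open>D\<close> to the power \<open>-1\<close> (with respect to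
  \<open>t\<^sub>i\<close>). Operator powers are expanded as if all symbols commuted, so a monomial in the symbols
  is a multiset; an operator term is a scalar times such a monomial.
\<close>

datatype symb = Tpos nat | Tneg nat | Deriv nat | Integ nat

type_synonym opterm = "complex \<times> symb multiset"

text \<open>
  The operator denoted by a monomial in \<open>t\<^sub>1, \<dots>, t\<^sub>N\<close>: first multiply by the positive powers of the
  variables, then apply the derivatives and integrals, then multiply by the negative powers.
\<close>

definition normal_ordered ::
  "nat \<Rightarrow> symb multiset \<Rightarrow> ((nat \<Rightarrow> real) \<Rightarrow> complex) \<Rightarrow> (nat \<Rightarrow> real) \<Rightarrow> complex" where
  "normal_ordered N M F =
     (let G = (\<lambda>t. (\<Prod>i=1..N. of_real (t i) ^ count M (Tpos i)) * F t);
          H = foldr (\<lambda>i. (deriv_var i ^^ count M (Deriv i)) \<circ> (integral_var i ^^ count M (Integ i)))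
                [1..<N+1] G
      in (\<lambda>t. (\<Prod>i=1..N. inverse (of_real (t i)) ^ count M (Tneg i)) * H t))"

fun apply_opterm ::
  "nat \<Rightarrow> opterm \<Rightarrow> ((nat \<Rightarrow> real) \<Rightarrow> complex) \<Rightarrow> (nat \<Rightarrow> real) \<Rightarrow> complex" where
  "apply_opterm N (w, M) F t = w * normal_ordered N M F t"

fun opterm_mult :: "opterm \<Rightarrow> opterm \<Rightarrow> opterm" where
  "opterm_mult (v, L) (w, M) = (v * w, L + M)"

fun opterm_power :: "opterm \<Rightarrow> nat \<Rightarrow> opterm" where
  "opterm_power (w, M) n = (w ^ n, repeat_mset n M)"

text \<open>
  The term with multi-index \<open>[n\<^sub>1, \<dots>, n\<^sub>k]\<close> in the multinomial expansion of
  \<open>1 - X\<^sub>1 - \<dots> - X\<^sub>k\<close> to the power \<open>-l\<close>.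
\<close>

definition neg_power_term :: "complex \<Rightarrow> opterm list \<Rightarrow> nat list \<Rightarrow> opterm" where
  "neg_power_term l Xs ns =
     opterm_mult (pochhammer l (sum_list ns) / (\<Prod>n\<leftarrow>ns. fact n), {#})
       (foldr opterm_mult (map2 opterm_power Xs ns) (1, {#}))"

text \<open>The monomial \<open>D\<^sub>i t\<^sub>j\<^sup>-\<^sup>1 D\<^sub>j\<^sup>-\<^sup>1 t\<^sub>i\<close>.\<close>

definition DtDt :: "nat \<Rightarrow> nat \<Rightarrow> symb multiset" where
  "DtDt i j = {#Deriv i, Tneg j, Integ j, Tpos i#}"

text \<open>The function \<open>t\<^sub>1\<^sup>k\<^sup>1\<^sup>-\<^sup>1 t\<^sub>2\<^sup>k\<^sup>2\<^sup>-\<^sup>1 \<dots>\<close> for an exponent list \<open>[k1, k2, \<dots>]\<close>.\<close>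

definition power_fun :: "complex list \<Rightarrow> (nat \<Rightarrow> real) \<Rightarrow> complex" where
  "power_fun ks t = (\<Prod>i<length ks. of_real (t (i + 1)) powr (ks ! i - 1))"

text \<open>
  \<open>K2_term\<close> and \<open>K2\<close> have the parameters
  \<open>[a,a,a,a; b,b,c,b; e\<^sub>1,e\<^sub>2,e\<^sub>3,e\<^sub>4; x,y,z,u]\<close>.
\<close>

definition K2_term ::
  "complex \<Rightarrow> complex \<Rightarrow> complex \<Rightarrow> complex \<Rightarrow> complex \<Rightarrow> complex \<Rightarrow> complex \<Rightarrow>
   complex \<Rightarrow> complex \<Rightarrow> complex \<Rightarrow> complex \<Rightarrow> nat \<times> nat \<times> nat \<times> nat \<Rightarrow> complex" where
  "K2_term a b c e1 e2 e3 e4 x y z u = (\<lambda>(m, n, p, q).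
     pochhammer a (m + n + p + q) * pochhammer b (m + n + q) * pochhammer c p /
     (pochhammer e1 m * pochhammer e2 n * pochhammer e3 p * pochhammer e4 q) *
     (x ^ m * y ^ n * z ^ p * u ^ q / (fact m * fact n * fact p * fact q)))"

definition K2 ::
  "complex \<Rightarrow> complex \<Rightarrow> complex \<Rightarrow> complex \<Rightarrow> complex \<Rightarrow> complex \<Rightarrow> complex \<Rightarrow>
   complex \<Rightarrow> complex \<Rightarrow> complex \<Rightarrow> complex \<Rightarrow> complex" where
  "K2 a b c e1 e2 e3 e4 x y z u = (\<Sum>\<^sub>\<infinity>k. K2_term a b c e1 e2 e3 e4 x y z u k)"

text \<open>
  The product of the power \<open>-b\<close> and the power \<open>-c\<close>, respectively the power \<open>-a\<close>, as a series
  of operator terms indexed by \<open>(m, n, p, q)\<close>, the exponents of \<open>x, y, z, u\<close>.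
\<close>

definition op_series1 ::
  "complex \<Rightarrow> complex \<Rightarrow> complex \<Rightarrow> complex \<Rightarrow> complex \<Rightarrow> complex \<Rightarrow>
   nat \<times> nat \<times> nat \<times> nat \<Rightarrow> opterm" where
  "op_series1 b c x y z u = (\<lambda>(m, n, p, q).
     opterm_mult
       (neg_power_term b [(x, DtDt 1 2), (y, DtDt 1 3), (u, DtDt 1 5)] [m, n, q])
       (neg_power_term c [(z, DtDt 1 4)] [p]))"

definition op_series2 ::
  "complex \<Rightarrow> complex \<Rightarrow> complex \<Rightarrow> complex \<Rightarrow> complex \<Rightarrow>
   nat \<times> nat \<times> nat \<times> nat \<Rightarrow> opterm" where
  "op_series2 a x y z u = (\<lambda>(m, n, p, q).
     neg_power_term a
       [(x, DtDt 1 3), (y, DtDt 1 4), (z, DtDt 2 5), (u, DtDt 1 6)] [m, n, p, q])"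

end

theory Submission
  imports Defs
begin

text \<open>
  Both identities hold term by term, and for one reason. An operator in normal order acts on a
  product of powers one variable at a time, and on a single power it only shifts the exponent and
  produces a Pochhammer symbol:
  \<open>D\<^sup>d t\<^bsup>\<kappa>-1\<^esup> = (\<kappa>-d)\<^sub>d t\<^bsup>\<kappa>-d-1\<^esup>\<close> and
  \<open>D\<^bsup>-m\<^esup> t\<^bsup>\<kappa>-1\<^esup> = t\<^bsup>\<kappa>+m-1\<^esup> / (\<kappa>)\<^sub>m\<close>, the latter for \<open>Re \<kappa> > 0\<close>, which makes the
  integral from \<open>0\<close> converge. These are the lemmas \<open>deriv_var_funpow\<close> and \<open>integral_var_funpow\<close>.

  In every monomial of the two expansions the symbols are balanced in each variable:
  multiplications and integrations raise the exponent by as much as derivatives and divisions lower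
  it. Hence the original product of powers is an eigenfunction (\<open>normal_ordered_balanced\<close>).
  A monomial is a product of factors \<open>D\<^sub>i t\<^sub>j\<^sup>-\<^sup>1 D\<^sub>j\<^sup>-\<^sup>1 t\<^sub>i\<close>; if \<open>d\<close> of them carry
  \<open>D\<^sub>i\<close>, the variable \<open>t\<^sub>i\<close> contributes \<open>(\<kappa>\<^sub>i)\<^sub>d\<close> to the eigenvalue, and if \<open>m\<close> of them carry
  \<open>D\<^sub>j\<^sup>-\<^sup>1\<close>, the variable \<open>t\<^sub>j\<close> contributes \<open>1 / (\<kappa>\<^sub>j)\<^sub>m\<close>. So \<open>t\<^sub>1\<close> supplies
  \<open>(a)\<^bsub>m+n+p+q\<^esub>\<close> in the first identity, whereas \<open>t\<^sub>1\<close> and \<open>t\<^sub>2\<close> supply \<open>(b)\<^bsub>m+n+q\<^esub>\<close> and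
  \<open>(c)\<^sub>p\<close> in the second; the remaining variables give the denominators, and the multinomial
  coefficients of the operator powers supply the numerator symbols still missing from the term of
  \<open>K\<^sub>2\<close>. Since every term is the same multiple of the corresponding term of \<open>K\<^sub>2\<close>, the sums
  agree as soon as the series \<open>K\<^sub>2\<close> converges.
\<close>

text \<open>
  Exponents are given by a function rather than a list, so that changing one of them is a function
  update. The offset \<open>-1\<close> makes the Pochhammer symbols below start at the parameter itself.
\<close>

definition monomial_fun :: "nat \<Rightarrow> (nat \<Rightarrow> complex) \<Rightarrow> (nat \<Rightarrow> real) \<Rightarrow> complex" where
  "monomial_fun N \<kappa> t = (\<Prod>i=1..N. of_real (t i) powr (\<kappa> i - 1))"

definition pos_orthant :: "nat \<Rightarrow> (nat \<Rightarrow> real) set" where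
  "pos_orthant N = {t. \<forall>i\<in>{1..N}. t i > 0}"

lemma pos_orthantD: "t \<in> pos_orthant N \<Longrightarrow> i \<in> {1..N} \<Longrightarrow> t i > 0"
  by (simp add: pos_orthant_def)

lemma pos_orthant_upd: "t \<in> pos_orthant N \<Longrightarrow> s > 0 \<Longrightarrow> t(i := s) \<in> pos_orthant N"
  by (simp add: pos_orthant_def)

lemma power_fun_eq_monomial_fun:
  "power_fun ks = monomial_fun (length ks) (\<lambda>i. ks ! (i - 1))"
  by (simp add: fun_eq_iff power_fun_def monomial_fun_def prod.atLeast1_atMost_eq)

lemma monomial_fun_slice:
  assumes "i \<in> {1..N}"
  shows "monomial_fun N \<kappa> (t(i := s)) =
           of_real s powr (\<kappa> i - 1) * (\<Prod>j\<in>{1..N} - {i}. of_real (t j) powr (\<kappa> j - 1))"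
proof -
  have "monomial_fun N \<kappa> (t(i := s)) =
          of_real s powr (\<kappa> i - 1) *
          (\<Prod>j\<in>{1..N} - {i}. of_real ((t(i := s)) j) powr (\<kappa> j - 1))"
    unfolding monomial_fun_def using assms by (subst prod.remove[of _ i]) auto
  also have "(\<Prod>j\<in>{1..N} - {i}. of_real ((t(i := s)) j) powr (\<kappa> j - 1)) =
             (\<Prod>j\<in>{1..N} - {i}. of_real (t j) powr (\<kappa> j - 1))"
    by (intro prod.cong) auto
  finally show ?thesis .
qed

lemma monomial_fun_slice_upd:
  assumes "i \<in> {1..N}"
  shows "monomial_fun N (\<kappa>(i := r)) t =
           of_real (t i) powr (r - 1) * (\<Prod>j\<in>{1..N} - {i}. of_real (t j) powr (\<kappa> j - 1))"
proof -
  have "monomial_fun N (\<kappa>(i := r)) t =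
          of_real (t i) powr (r - 1) *
          (\<Prod>j\<in>{1..N} - {i}. of_real (t j) powr ((\<kappa>(i := r)) j - 1))"
    using monomial_fun_slice[OF assms, of "\<kappa>(i := r)" t "t i"] by simp
  also have "(\<Prod>j\<in>{1..N} - {i}. of_real (t j) powr ((\<kappa>(i := r)) j - 1)) =
             (\<Prod>j\<in>{1..N} - {i}. of_real (t j) powr (\<kappa> j - 1))"
    by (intro prod.cong) auto
  finally show ?thesis .
qed

section \<open>Derivatives and integrals of products of powers\<close>

text \<open>
  The operand is only assumed to be a multiple of a product of powers on the open orthant: a
  derivative is local, and an integral from \<open>0\<close> ignores the value at the endpoint. The conclusion
  has the same form, so that these lemmas can be iterated.
\<close>

lemma deriv_var_monomial_fun:
  assumes F: "\<And>t. t \<in> pos_orthant N \<Longrightarrow> F t = C * monomial_fun N \<kappa> t"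
    and i: "i \<in> {1..N}" and t: "t \<in> pos_orthant N"
  shows "deriv_var i F t = C * (\<kappa> i - 1) * monomial_fun N (\<kappa>(i := \<kappa> i - 1)) t"
proof -
  define R where "R = (\<Prod>j\<in>{1..N} - {i}. complex_of_real (t j) powr (\<kappa> j - 1))"
  have ti: "t i > 0"
    using t i by (rule pos_orthantD)
  have "((\<lambda>w. C * (w powr (\<kappa> i - 1) * R)) has_field_derivative
          C * ((\<kappa> i - 1) * of_real (t i) powr (\<kappa> i - 1 - 1) * R)) (at (of_real (t i)))"
    using ti by (intro DERIV_cmult DERIV_cmult_right has_field_derivative_powr)
      (auto simp: complex_nonpos_Reals_iff)
  then have "((\<lambda>s. C * (of_real s powr (\<kappa> i - 1) * R)) has_vector_derivative
          C * ((\<kappa> i - 1) * of_real (t i) powr (\<kappa> i - 1 - 1) * R)) (at (t i))"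
    by (rule has_vector_derivative_real_field)
  then have "((\<lambda>s. F (t(i := s))) has_vector_derivative
          C * ((\<kappa> i - 1) * of_real (t i) powr (\<kappa> i - 1 - 1) * R)) (at (t i))"
  proof (rule has_vector_derivative_transform_within_open[where S = "{0<..}"])
    fix s :: real assume "s \<in> {0<..}"
    then show "C * (of_real s powr (\<kappa> i - 1) * R) = F (t(i := s))"
      using F[OF pos_orthant_upd[OF t, of s i]] monomial_fun_slice[OF i, of \<kappa> t s]
      by (simp add: R_def)
  qed (use ti in auto)
  then have "deriv_var i F t = C * ((\<kappa> i - 1) * of_real (t i) powr (\<kappa> i - 1 - 1) * R)"
    unfolding deriv_var_def by (rule vector_derivative_at)
  then show ?thesis
    using monomial_fun_slice_upd[OF i, of \<kappa> "\<kappa> i - 1" t] by (simp add: R_def mult_ac)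
qed

lemma integral_var_monomial_fun:
  assumes F: "\<And>t. t \<in> pos_orthant N \<Longrightarrow> F t = C * monomial_fun N \<kappa> t"
    and i: "i \<in> {1..N}" and pos: "Re (\<kappa> i) > 0" and t: "t \<in> pos_orthant N"
  shows "integral_var i F t = C / \<kappa> i * monomial_fun N (\<kappa>(i := \<kappa> i + 1)) t"
proof -
  define R where "R = (\<Prod>j\<in>{1..N} - {i}. complex_of_real (t j) powr (\<kappa> j - 1))"
  have ti: "t i > 0"
    using t i by (rule pos_orthantD)
  have nz: "\<kappa> i \<noteq> 0"
    using pos by auto
  define A where "A = (\<lambda>s. (C * R / \<kappa> i) * complex_of_real s powr \<kappa> i)"
  have "((\<lambda>s. C * (of_real s powr (\<kappa> i - 1) * R)) has_integral A (t i) - A 0) {0..t i}"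
  proof (rule fundamental_theorem_of_calculus_interior)
    (* The integrand may be unbounded at 0, but the primitive is continuous there: Re (\<kappa> i) > 0. *)
    show "continuous_on {0..t i} A"
      unfolding A_def using pos by (intro continuous_intros) auto
  next
    fix s :: real assume s: "s \<in> {0<..<t i}"
    have "((\<lambda>w. (C * R / \<kappa> i) * w powr \<kappa> i) has_field_derivative
            (C * R / \<kappa> i) * (\<kappa> i * of_real s powr (\<kappa> i - 1))) (at (of_real s))"
      using s by (intro DERIV_cmult has_field_derivative_powr)
        (auto simp: complex_nonpos_Reals_iff)
    then have "(A has_vector_derivative (C * R / \<kappa> i) * (\<kappa> i * of_real s powr (\<kappa> i - 1))) (at s)"
      unfolding A_def by (rule has_vector_derivative_real_field)
    then show "(A has_vector_derivative C * (of_real s powr (\<kappa> i - 1) * R)) (at s)"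
      using nz by (simp add: mult_ac)
  qed (use ti in auto)
  then have "((\<lambda>s. F (t(i := s))) has_integral A (t i) - A 0) {0..t i}"
  proof (rule has_integral_spike[OF negligible_sing[of 0], rotated])
    fix s assume "s \<in> {0..t i} - {0}"
    then show "F (t(i := s)) = C * (of_real s powr (\<kappa> i - 1) * R)"
      using F[OF pos_orthant_upd[OF t, of s i]] monomial_fun_slice[OF i, of \<kappa> t s]
      by (simp add: R_def)
  qed
  then have "integral_var i F t = A (t i) - A 0"
    unfolding integral_var_def by (rule integral_unique)
  then show ?thesis
    using monomial_fun_slice_upd[OF i, of \<kappa> "\<kappa> i + 1" t] by (simp add: A_def R_def mult_ac)
qed

lemma deriv_var_funpow:
  assumes F: "\<And>t. t \<in> pos_orthant N \<Longrightarrow> F t = C * monomial_fun N \<kappa> t"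
    and i: "i \<in> {1..N}" and t: "t \<in> pos_orthant N"
  shows "(deriv_var i ^^ d) F t =
           C * pochhammer (\<kappa> i - of_nat d) d * monomial_fun N (\<kappa>(i := \<kappa> i - of_nat d)) t"
  using t
proof (induction d arbitrary: t)
  case 0
  then show ?case by (simp add: F)
next
  case (Suc d)
  have "(deriv_var i ^^ Suc d) F t =
          C * pochhammer (\<kappa> i - of_nat d) d * (\<kappa> i - of_nat d - 1) *
          monomial_fun N (\<kappa>(i := \<kappa> i - of_nat d - 1)) t"
    using deriv_var_monomial_fun[OF Suc.IH i Suc.prems] by (simp del: fun_upd_apply add: fun_upd_same)
  moreover have "pochhammer (\<kappa> i - of_nat (Suc d)) (Suc d) =
                   (\<kappa> i - of_nat d - 1) * pochhammer (\<kappa> i - of_nat d) d"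
    by (subst pochhammer_rec) (simp add: algebra_simps)
  moreover have "\<kappa> i - of_nat (Suc d) = \<kappa> i - of_nat d - 1"
    by simp
  ultimately show ?case
    by (simp only: mult_ac)
qed

lemma integral_var_funpow:
  assumes F: "\<And>t. t \<in> pos_orthant N \<Longrightarrow> F t = C * monomial_fun N \<kappa> t"
    and i: "i \<in> {1..N}" and pos: "Re (\<kappa> i) > 0" and t: "t \<in> pos_orthant N"
  shows "(integral_var i ^^ m) F t =
           C / pochhammer (\<kappa> i) m * monomial_fun N (\<kappa>(i := \<kappa> i + of_nat m)) t"
  using t
proof (induction m arbitrary: t)
  case 0
  then show ?case by (simp add: F)
next
  case (Suc m)
  have "Re ((\<kappa>(i := \<kappa> i + of_nat m)) i) > 0"
    using pos by simp
  from integral_var_monomial_fun[OF Suc.IH i this Suc.prems] show ?case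
    by (simp del: fun_upd_apply add: fun_upd_same pochhammer_Suc add_ac)
qed

section \<open>Operators in normal order\<close>

text \<open>
  The scalar produced by \<open>D\<^sup>d D\<^bsup>-m\<^esup>\<close> on \<open>t\<^bsup>k-1\<^esup>\<close>; it agrees with
  \<open>\<Gamma>(k) / \<Gamma>(k+m-d)\<close> wherever the latter makes sense.
\<close>

definition shift_factor :: "complex \<Rightarrow> nat \<Rightarrow> nat \<Rightarrow> complex" where
  "shift_factor k d m = pochhammer (k + of_nat m - of_nat d) d / pochhammer k m"

lemma deriv_integral_funpow:
  assumes F: "\<And>t. t \<in> pos_orthant N \<Longrightarrow> F t = C * monomial_fun N \<kappa> t"
    and i: "i \<in> {1..N}" and pos: "Re (\<kappa> i) > 0" and t: "t \<in> pos_orthant N"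
  shows "((deriv_var i ^^ d) \<circ> (integral_var i ^^ m)) F t =
           C * shift_factor (\<kappa> i) d m * monomial_fun N (\<kappa>(i := \<kappa> i + of_nat m - of_nat d)) t"
  using deriv_var_funpow[OF integral_var_funpow[where m = m, OF F i pos] i t, of d]
  by (simp add: shift_factor_def)

text \<open>
  Different variables do not interact: the operator in \<open>t\<^sub>i\<close> leaves the other exponents alone, so
  the factors simply multiply, and the exponent of \<open>t\<^sub>i\<close> still has positive real part when its
  operator is reached.
\<close>

lemma foldr_deriv_integral:
  assumes F: "\<And>t. t \<in> pos_orthant N \<Longrightarrow> F t = C * monomial_fun N \<kappa> t"
    and pos: "\<And>i. i \<in> {1..N} \<Longrightarrow> Re (\<kappa> i) > 0"
    and "distinct is" "set is \<subseteq> {1..N}" and t: "t \<in> pos_orthant N"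
  shows "foldr (\<lambda>i. (deriv_var i ^^ d i) \<circ> (integral_var i ^^ m i)) is F t =
           C * (\<Prod>i\<in>set is. shift_factor (\<kappa> i) (d i) (m i)) *
           monomial_fun N (\<lambda>i. if i \<in> set is then \<kappa> i + of_nat (m i) - of_nat (d i) else \<kappa> i) t"
  using assms(3-)
proof (induction "is" arbitrary: t)
  case Nil
  then show ?case by (simp add: F)
next
  case (Cons i js)
  define \<kappa>' where "\<kappa>' = (\<lambda>j. if j \<in> set js then \<kappa> j + of_nat (m j) - of_nat (d j) else \<kappa> j)"
  have i: "i \<in> {1..N}" and i_js: "i \<notin> set js"
    using Cons.prems by auto
  have \<kappa>'_i: "\<kappa>' i = \<kappa> i"
    using i_js by (simp add: \<kappa>'_def)
  have IH: "foldr (\<lambda>i. (deriv_var i ^^ d i) \<circ> (integral_var i ^^ m i)) js F s =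
              C * (\<Prod>i\<in>set js. shift_factor (\<kappa> i) (d i) (m i)) * monomial_fun N \<kappa>' s"
    if "s \<in> pos_orthant N" for s
    unfolding \<kappa>'_def using Cons.prems that by (intro Cons.IH) auto
  have upd: "\<kappa>'(i := \<kappa> i + of_nat (m i) - of_nat (d i)) =
               (\<lambda>j. if j \<in> set (i # js) then \<kappa> j + of_nat (m j) - of_nat (d j) else \<kappa> j)"
    by (auto simp: \<kappa>'_def fun_eq_iff)
  have "Re (\<kappa>' i) > 0"
    using pos[OF i] by (simp add: \<kappa>'_i)
  from deriv_integral_funpow[OF IH i this Cons.prems(3), of "d i" "m i"] show ?case
    unfolding \<kappa>'_i upd using i_js by (simp add: comp_def mult_ac)
qed

lemma monomial_fun_mult_powers:
  assumes "t \<in> pos_orthant N"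
  shows "(\<Prod>i=1..N. of_real (t i) ^ n i) * monomial_fun N \<kappa> t =
           monomial_fun N (\<lambda>i. \<kappa> i + of_nat (n i)) t"
  unfolding monomial_fun_def prod.distrib[symmetric]
proof (intro prod.cong refl)
  fix i assume "i \<in> {1..N}"
  then have "t i \<noteq> 0"
    using pos_orthantD[OF assms, of i] by simp
  then have "complex_of_real (t i) powr (\<kappa> i - 1 + of_nat (n i)) =
               of_real (t i) powr (\<kappa> i - 1) * of_real (t i) ^ n i"
    by (simp add: powr_add powr_nat')
  then show "of_real (t i) ^ n i * complex_of_real (t i) powr (\<kappa> i - 1) =
               of_real (t i) powr (\<kappa> i + of_nat (n i) - 1)"
    by (simp add: algebra_simps)
qed

lemma monomial_fun_divide_powers:
  assumes "t \<in> pos_orthant N"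
  shows "(\<Prod>i=1..N. inverse (of_real (t i)) ^ n i) * monomial_fun N (\<lambda>i. \<kappa> i + of_nat (n i)) t =
           monomial_fun N \<kappa> t"
proof -
  have "(\<Prod>i=1..N. inverse (of_real (t i)) ^ n i) * (\<Prod>i=1..N. of_real (t i) ^ n i) = (1 :: complex)"
    unfolding prod.distrib[symmetric]
  proof (intro prod.neutral ballI)
    fix i assume "i \<in> {1..N}"
    then have "t i \<noteq> 0"
      using pos_orthantD[OF assms, of i] by simp
    then show "inverse (of_real (t i)) ^ n i * of_real (t i) ^ n i = (1 :: complex)"
      by (simp add: power_mult_distrib[symmetric])
  qed
  then show ?thesis
    by (simp add: monomial_fun_mult_powers[OF assms, of n \<kappa>, symmetric] mult.assoc[symmetric])
qed

text \<open>
  The balance condition says that in each variable the symbols raising the exponent are as many as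
  those lowering it; this is what makes the product of powers an eigenfunction.
\<close>

lemma normal_ordered_balanced:
  assumes pos: "\<And>i. i \<in> {1..N} \<Longrightarrow> Re (\<kappa> i) > 0"
    and balanced: "\<And>i. i \<in> {1..N} \<Longrightarrow>
          count M (Tpos i) + count M (Integ i) = count M (Deriv i) + count M (Tneg i)"
    and t: "t \<in> pos_orthant N"
  shows "normal_ordered N M (monomial_fun N \<kappa>) t =
           (\<Prod>i=1..N. shift_factor (\<kappa> i + of_nat (count M (Tpos i)))
                        (count M (Deriv i)) (count M (Integ i))) *
           monomial_fun N \<kappa> t"
proof -
  define G where "G = (\<lambda>t. (\<Prod>i=1..N. of_real (t i) ^ count M (Tpos i)) * monomial_fun N \<kappa> t)"
  define \<kappa>' where "\<kappa>' = (\<lambda>i. \<kappa> i + of_nat (count M (Tpos i)))"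
  have G: "G s = 1 * monomial_fun N \<kappa>' s" if "s \<in> pos_orthant N" for s
    using monomial_fun_mult_powers[OF that] by (simp add: G_def \<kappa>'_def)
  have "Re (\<kappa>' i) > 0" if "i \<in> {1..N}" for i
    using pos[OF that] by (simp add: \<kappa>'_def)
  from foldr_deriv_integral[OF G this, of "[1..<N+1]" t
      "\<lambda>i. count M (Deriv i)" "\<lambda>i. count M (Integ i)"]
  have H: "foldr (\<lambda>i. (deriv_var i ^^ count M (Deriv i)) \<circ> (integral_var i ^^ count M (Integ i)))
            [1..<N+1] G t =
          (\<Prod>i=1..N. shift_factor (\<kappa>' i) (count M (Deriv i)) (count M (Integ i))) *
          monomial_fun N (\<lambda>i. if i \<in> {1..N} then \<kappa>' i + of_nat (count M (Integ i)) -
             of_nat (count M (Deriv i)) else \<kappa>' i) t" (is "_ = ?c * monomial_fun N ?\<mu> t")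
    using t by (simp add: atLeastLessThanSuc_atLeastAtMost del: upt_Suc)
  have "monomial_fun N ?\<mu> t = monomial_fun N (\<lambda>i. \<kappa> i + of_nat (count M (Tneg i))) t"
    unfolding monomial_fun_def
  proof (intro prod.cong refl)
    fix i assume i: "i \<in> {1..N}"
    have "of_nat (count M (Tpos i)) + of_nat (count M (Integ i)) =
            (of_nat (count M (Deriv i)) + of_nat (count M (Tneg i)) :: complex)"
      using balanced[OF i] by (simp flip: of_nat_add)
    then have "?\<mu> i = \<kappa> i + of_nat (count M (Tneg i))"
      using i by (simp add: \<kappa>'_def add.assoc)
    then show "complex_of_real (t i) powr (?\<mu> i - 1) =
                 of_real (t i) powr (\<kappa> i + of_nat (count M (Tneg i)) - 1)"
      by (simp only:)
  qed
  with H have H': "foldr (\<lambda>i. (deriv_var i ^^ count M (Deriv i)) \<circ> (integral_var i ^^ count M (Integ i)))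
            [1..<N+1] G t = ?c * monomial_fun N (\<lambda>i. \<kappa> i + of_nat (count M (Tneg i))) t"
    by (simp only:)
  show ?thesis
    unfolding normal_ordered_def Let_def G_def[symmetric] H'
    by (simp add: \<kappa>'_def mult.left_commute
          flip: monomial_fun_divide_powers[OF t, of "\<lambda>i. count M (Tneg i)" \<kappa>])
qed

text \<open>
  In a monomial built from the factors \<open>DtDt i j\<close>, derivatives come paired with multiplications by
  the same variable, and integrals with divisions, which is a special way of being balanced.
  If each variable is only differentiated or only integrated, its factor is a single Pochhammer
  symbol.
\<close>

lemma shift_factor_deriv: "shift_factor (k + of_nat d) d 0 = pochhammer k d"
  by (simp add: shift_factor_def)

lemma shift_factor_integral: "shift_factor k 0 m = 1 / pochhammer k m"
  by (simp add: shift_factor_def)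

lemma normal_ordered_power_fun:
  assumes pos: "\<And>k. k \<in> set ks \<Longrightarrow> Re k > 0"
    and paired: "\<And>i. count M (Tpos i) = count M (Deriv i)" "\<And>i. count M (Tneg i) = count M (Integ i)"
    and t: "\<forall>i\<in>{1..length ks}. t i > 0"
  shows "normal_ordered (length ks) M (power_fun ks) t =
           (\<Prod>i<length ks. shift_factor (ks ! i + of_nat (count M (Deriv (Suc i))))
                            (count M (Deriv (Suc i))) (count M (Integ (Suc i)))) *
           power_fun ks t"
proof -
  have "Re (ks ! (i - 1)) > 0" if "i \<in> {1..length ks}" for i
    using that by (intro pos nth_mem) auto
  then show ?thesis
    unfolding power_fun_eq_monomial_fun using t
    by (subst normal_ordered_balanced) (simp_all add: paired pos_orthant_def prod.atLeast1_atMost_eq)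
qed

section \<open>The two operator series\<close>

lemma op_series1_term:
  assumes pos: "Re a > 0" "Re e1 > 0" "Re e2 > 0" "Re e3 > 0" "Re e4 > 0"
    and t: "\<forall>i\<in>{1..5}. t i > 0"
  shows "apply_opterm 5 (op_series1 b c x y z u k) (power_fun [a, e1, e2, e3, e4]) t =
           power_fun [a, e1, e2, e3, e4] t * K2_term a b c e1 e2 e3 e4 x y z u k"
proof -
  obtain m n p q where k: "k = (m, n, p, q)"
    by (cases k)
  define M where "M = snd (op_series1 b c x y z u k)"
  define w where "w = fst (op_series1 b c x y z u k)"
  have w: "w = pochhammer b (m + n + q) * pochhammer c p *
               (x ^ m * y ^ n * z ^ p * u ^ q / (fact m * fact n * fact p * fact q))"
    by (simp add: w_def k op_series1_def neg_power_term_def add_ac mult_ac)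
  have M: "M = repeat_mset m (DtDt 1 2) + repeat_mset n (DtDt 1 3) + repeat_mset q (DtDt 1 5) +
               repeat_mset p (DtDt 1 4)"
    by (simp add: M_def k op_series1_def neg_power_term_def add_ac)
  (* t 1 is differentiated m+n+p+q times; t 2, ..., t 5 are integrated m, n, p, q times. *)
  have "normal_ordered (length [a, e1, e2, e3, e4]) M (power_fun [a, e1, e2, e3, e4]) t =
          pochhammer a (m + n + p + q) /
          (pochhammer e1 m * pochhammer e2 n * pochhammer e3 p * pochhammer e4 q) *
          power_fun [a, e1, e2, e3, e4] t"
    using pos t
    by (subst normal_ordered_power_fun)
       (auto simp: M DtDt_def shift_factor_deriv shift_factor_integral lessThan_Suc add_ac mult_ac
             simp flip: of_nat_add)
  then have "apply_opterm 5 (w, M) (power_fun [a, e1, e2, e3, e4]) t =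
          w * (pochhammer a (m + n + p + q) /
          (pochhammer e1 m * pochhammer e2 n * pochhammer e3 p * pochhammer e4 q) *
          power_fun [a, e1, e2, e3, e4] t)"
    by (simp add: numeral_eq_Suc)
  moreover have "op_series1 b c x y z u k = (w, M)"
    by (simp add: w_def M_def)
  ultimately show ?thesis
    by (simp add: w k K2_term_def mult_ac)
qed

lemma op_series2_term:
  assumes pos: "Re b > 0" "Re c > 0" "Re e1 > 0" "Re e2 > 0" "Re e3 > 0" "Re e4 > 0"
    and t: "\<forall>i\<in>{1..6}. t i > 0"
  shows "apply_opterm 6 (op_series2 a x y z u k) (power_fun [b, c, e1, e2, e3, e4]) t =
           power_fun [b, c, e1, e2, e3, e4] t * K2_term a b c e1 e2 e3 e4 x y z u k"
proof -
  obtain m n p q where k: "k = (m, n, p, q)"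
    by (cases k)
  define M where "M = snd (op_series2 a x y z u k)"
  define w where "w = fst (op_series2 a x y z u k)"
  have w: "w = pochhammer a (m + n + p + q) *
               (x ^ m * y ^ n * z ^ p * u ^ q / (fact m * fact n * fact p * fact q))"
    by (simp add: w_def k op_series2_def neg_power_term_def add_ac mult_ac)
  have M: "M = repeat_mset m (DtDt 1 3) + repeat_mset n (DtDt 1 4) + repeat_mset p (DtDt 2 5) +
               repeat_mset q (DtDt 1 6)"
    by (simp add: M_def k op_series2_def neg_power_term_def add_ac)
  (* t 1 and t 2 are differentiated m+n+q and p times; t 3, ..., t 6 are integrated
     m, n, p, q times. *)
  have "normal_ordered (length [b, c, e1, e2, e3, e4]) M (power_fun [b, c, e1, e2, e3, e4]) t =
          pochhammer b (m + n + q) * pochhammer c p /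
          (pochhammer e1 m * pochhammer e2 n * pochhammer e3 p * pochhammer e4 q) *
          power_fun [b, c, e1, e2, e3, e4] t"
    using pos t
    by (subst normal_ordered_power_fun)
       (auto simp: M DtDt_def shift_factor_deriv shift_factor_integral lessThan_Suc add_ac mult_ac
             simp flip: of_nat_add)
  then have "apply_opterm 6 (w, M) (power_fun [b, c, e1, e2, e3, e4]) t =
          w * (pochhammer b (m + n + q) * pochhammer c p /
          (pochhammer e1 m * pochhammer e2 n * pochhammer e3 p * pochhammer e4 q) *
          power_fun [b, c, e1, e2, e3, e4] t)"
    by (simp add: numeral_eq_Suc)
  moreover have "op_series2 a x y z u k = (w, M)"
    by (simp add: w_def M_def)
  ultimately show ?thesis
    by (simp add: w k K2_term_def mult_ac)
qed

theorem theorem3p1: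
  fixes a b c e1 e2 e3 e4 x y z u :: complex
  assumes "Re a > 0" and "Re b > 0" and "Re c > 0"
    and "Re e1 > 0" and "Re e2 > 0" and "Re e3 > 0" and "Re e4 > 0"
  shows
    "(\<forall>t. (\<forall>i\<in>{1..5}. t i > 0) \<longrightarrow>
        (\<forall>k. apply_opterm 5 (op_series1 b c x y z u k) (power_fun [a, e1, e2, e3, e4]) t
             = power_fun [a, e1, e2, e3, e4] t * K2_term a b c e1 e2 e3 e4 x y z u k) \<and>
        (K2_term a b c e1 e2 e3 e4 x y z u summable_on UNIV \<longrightarrow>
          ((\<lambda>k. apply_opterm 5 (op_series1 b c x y z u k) (power_fun [a, e1, e2, e3, e4]) t)
            has_sum power_fun [a, e1, e2, e3, e4] t * K2 a b c e1 e2 e3 e4 x y z u) UNIV)) \<and>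
     (\<forall>t. (\<forall>i\<in>{1..6}. t i > 0) \<longrightarrow>
        (\<forall>k. apply_opterm 6 (op_series2 a x y z u k) (power_fun [b, c, e1, e2, e3, e4]) t
             = power_fun [b, c, e1, e2, e3, e4] t * K2_term a b c e1 e2 e3 e4 x y z u k) \<and>
        (K2_term a b c e1 e2 e3 e4 x y z u summable_on UNIV \<longrightarrow>
          ((\<lambda>k. apply_opterm 6 (op_series2 a x y z u k) (power_fun [b, c, e1, e2, e3, e4]) t)
            has_sum power_fun [b, c, e1, e2, e3, e4] t * K2 a b c e1 e2 e3 e4 x y z u) UNIV))"
proof -
  have sum: "((\<lambda>k. P * K2_term a b c e1 e2 e3 e4 x y z u k) has_sum
               P * K2 a b c e1 e2 e3 e4 x y z u) UNIV"
    if "K2_term a b c e1 e2 e3 e4 x y z u summable_on UNIV" for P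
    unfolding K2_def by (intro has_sum_cmult_right has_sum_infsum that)
  show ?thesis
    using assms by (simp add: op_series1_term op_series2_term sum)
qed

end
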